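(* Let $X$ be a three-dimensional real Banach space, $V\subset X$ a two-dimensional subspace, and $A\in B(V)$ with $\|A\|_{w,V}>0$. Suppose $$\lambda_w^A:=\inf\{\|A_0\|_w: A_0\in B(X,V),\ A_0|_V=A\}>\|A\|,$$ where $\|A\|$ is the operator norm of $A$. Then there exists exactly one $A_0\in B(X,V)$ with $A_0|_V=A$ and $\|A_0\|_w=\lambda_w^A$. Moreover there is $r>0$ such that $$\|A_0-L\|_w\ge\|A_0\|_w+r\|L\|_w\quad\text{for all }L\in B_V(X,V),$$ i.e. $0$ is a strongly unique best approximation to $A_0$ in $B_V(X,V)$ with respect to the numerical radius; equivalently $\|B\|_w\ge\|A_0\|_w+r\|B-A_0\|_w$ for every $B\in B(X,V)$ with $B|_V=A$.
   Context: $B(X,V)$ denotes linear operators $X\to V$, regarded as operators $X\to X$; $B_V(X,V)=\{L\in B(X,V):L|_V=0\}$. For $T\in B(X)$ the numerical radius is $\|T\|_w=\sup\{|x^*(Tx)|:x\in S_X,x^*\in S_{X^*},x^*(x)=1\}$. For $A\in B(V)$, $\|A\|_{w,V}=\sup\{|v^*(Av)|:v^*\in B_{V^*},v\in B_V,v^*(v)=1\}$. *)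

theory Defs
  imports "HOL-Analysis.Analysis"
begin

text \<open>Operators X to V (regarded as operators on X): linear maps on X with range in V.
  In finite dimensions every linear map is bounded.\<close>
definition BXV :: "'a::real_normed_vector set \<Rightarrow> ('a \<Rightarrow> 'a) set" where
  "BXV V = {L. linear L \<and> range L \<subseteq> V}"

definition BVXV :: "'a::real_normed_vector set \<Rightarrow> ('a \<Rightarrow> 'a) set" where
  "BVXV V = {L \<in> BXV V. \<forall>v\<in>V. L v = 0}"

definition linear_on_sub :: "'a::real_vector set \<Rightarrow> ('a \<Rightarrow> 'b::real_vector) \<Rightarrow> bool" where
  "linear_on_sub V f \<longleftrightarrow> (\<forall>x\<in>V. \<forall>y\<in>V. f (x + y) = f x + f y) \<and>
                          (\<forall>c. \<forall>x\<in>V. f (c *\<^sub>R x) = c *\<^sub>R f x)"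

definition BV :: "'a::real_normed_vector set \<Rightarrow> ('a \<Rightarrow> 'a) set" where
  "BV V = {A. linear_on_sub V A \<and> (\<forall>v\<in>V. A v \<in> V)}"

definition numrad :: "('a::real_normed_vector \<Rightarrow> 'a) \<Rightarrow> real" where
  "numrad T = Sup {\<bar>f (T x)\<bar> | x f. norm x = 1 \<and> bounded_linear f \<and> onorm f = 1 \<and> f x = 1}"

definition numrad_on :: "'a::real_normed_vector set \<Rightarrow> ('a \<Rightarrow> 'a) \<Rightarrow> real" where
  "numrad_on V A = Sup {\<bar>f (A v)\<bar> | v f. v \<in> V \<and> norm v \<le> 1 \<and>
        linear_on_sub V (f :: 'a \<Rightarrow> real) \<and> (\<forall>u\<in>V. \<bar>f u\<bar> \<le> norm u) \<and> f v = 1}"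

definition opnorm_on :: "'a::real_normed_vector set \<Rightarrow> ('a \<Rightarrow> 'a) \<Rightarrow> real" where
  "opnorm_on V A = Sup {norm (A v) | v. v \<in> V \<and> norm v \<le> 1}"

definition extensions :: "'a::real_normed_vector set \<Rightarrow> ('a \<Rightarrow> 'a) \<Rightarrow> ('a \<Rightarrow> 'a) set" where
  "extensions V A = {A0 \<in> BXV V. \<forall>v\<in>V. A0 v = A v}"

definition lambda_w :: "'a::real_normed_vector set \<Rightarrow> ('a \<Rightarrow> 'a) \<Rightarrow> real" where
  "lambda_w V A = Inf (numrad ` extensions V A)"

end

(* Choose coordinates X = V x R, so that the extensions of A form a two-parameter family with
   parameter c in V, and the numerical radius of an extension is N c, the supremum over the compact
   set of states s = (x, f) of |base s + <slope s, c>|, where slope s is a multiple of f restricted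
   to V. At a minimum c0 of N the vectors k s = val s c0 * slope s, for s extremal, do not lie in an
   open half plane (Kolmogorov). If they did not surround the origin strictly, then, as dim V = 2, two
   of them would be opposite. Since N c0 > ||A||, the points of these two states lie outside V, and a
   suitable combination of them is a vector of V on which A has norm at least N c0 > ||A||, a
   contradiction. Strict surrounding and compactness give strong uniqueness. *)
theory Submission
  imports Defs
begin

section \<open>Compact sets and the sign of their support functions\<close>

lemma compact_subsequence:
  fixes f :: "nat \<Rightarrow> 'a::first_countable_topology"
  assumes "compact K" "\<And>n. f n \<in> K"
  obtains l r where "l \<in> K" "strict_mono (r :: nat \<Rightarrow> nat)" "(\<lambda>n. f (r n)) \<longlonglongrightarrow> l"
proof (rule seq_compactE[OF compact_imp_seq_compact[OF assms(1)], of f])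
  show "\<forall>n. f n \<in> K" using assms(2) by simp
  fix l and r :: "nat \<Rightarrow> nat"
  assume "l \<in> K" "strict_mono r" "(f \<circ> r) \<longlonglongrightarrow> l"
  then show thesis by (intro that) (simp_all add: o_def)
qed

text \<open>Tilt \<open>v\<close> slightly towards \<open>w\<close>. A point of \<open>K\<close>
  with nonnegative product against the tilted vector has nonnegative product with \<open>w\<close>,
  because its product with \<open>v\<close> is at most 0. As the tilt shrinks, a limit of such
  points also has nonnegative product with \<open>v\<close>, hence product 0.\<close>

lemma compact_support_zero:
  fixes K :: "'c::real_inner set"
  assumes "compact K" and pos: "\<And>u. \<exists>k\<in>K. 0 \<le> k \<bullet> u" and v: "\<And>k. k \<in> K \<Longrightarrow> k \<bullet> v \<le> 0"
  shows "\<exists>k\<in>K. k \<bullet> v = 0 \<and> 0 \<le> k \<bullet> w"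
proof -
  define t where "t n = inverse (real (Suc n))" for n
  have t0: "t n > 0" for n by (simp add: t_def)
  have t: "t \<longlonglongrightarrow> 0" unfolding t_def by (rule LIMSEQ_inverse_real_of_nat)
  have "\<exists>k. \<forall>n. k n \<in> K \<and> 0 \<le> k n \<bullet> (v + t n *\<^sub>R w)"
    by (intro choice allI) (use pos in \<open>simp add: Bex_def\<close>)
  then obtain k where kK: "\<And>n. k n \<in> K" and k: "\<And>n. 0 \<le> k n \<bullet> (v + t n *\<^sub>R w)" by blast
  obtain l r where l: "l \<in> K" "strict_mono r" and lim: "(\<lambda>n. k (r n)) \<longlonglongrightarrow> l"
    by (rule compact_subsequence[of K k, OF assms(1) kK])
  have tr: "(\<lambda>n. t (r n)) \<longlonglongrightarrow> 0" using LIMSEQ_subseq_LIMSEQ[OF t l(2)] by (simp add: o_def)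
  have w: "0 \<le> k n \<bullet> w" for n
  proof -
    have "0 \<le> t n * (k n \<bullet> w)" using k[of n] v[OF kK, of n] by (simp add: inner_add_right)
    then show ?thesis using t0[of n] by (simp add: zero_le_mult_iff)
  qed
  have "0 \<le> l \<bullet> w"
    by (rule LIMSEQ_le_const[OF tendsto_inner[OF lim tendsto_const]]) (use w in auto)
  moreover have "(\<lambda>n. k (r n) \<bullet> (v + t (r n) *\<^sub>R w)) \<longlonglongrightarrow> l \<bullet> (v + 0 *\<^sub>R w)"
    by (intro tendsto_intros lim tr)
  then have "0 \<le> l \<bullet> (v + 0 *\<^sub>R w)"
    by (rule LIMSEQ_le_const) (use k in auto)
  ultimately show ?thesis using l(1) v[OF l(1)] by force
qed

text \<open>Compactness of the unit sphere makes positivity uniform: directions that defeat the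
  constants 1/(n+1) accumulate at a unit vector against which no point of \<open>K\<close> is
  positive.\<close>

lemma compact_support_pos:
  fixes K :: "'c::euclidean_space set"
  assumes "compact K" and pos: "\<And>u. norm u = 1 \<Longrightarrow> \<exists>k\<in>K. 0 < k \<bullet> u"
  shows "\<exists>r>0. \<forall>u. \<exists>k\<in>K. r * norm u \<le> k \<bullet> u"
proof (rule ccontr)
  assume neg: "\<not> ?thesis"
  have "\<exists>u. norm u = 1 \<and> (\<forall>k\<in>K. k \<bullet> u \<le> inverse (real (Suc n)))" for n
  proof -
    have "inverse (real (Suc n)) > 0" by simp
    with neg have "\<not> (\<forall>u. \<exists>k\<in>K. inverse (real (Suc n)) * norm u \<le> k \<bullet> u)" by blast
    then obtain u where u: "\<And>k. k \<in> K \<Longrightarrow> k \<bullet> u < inverse (real (Suc n)) * norm u"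
      by (meson not_le)
    obtain e :: 'c where "norm e = 1" using vector_choose_size[of 1] by auto
    then obtain k where "k \<in> K" using pos by blast
    \<comment> \<open>At \<open>u = 0\<close> the strict bound for this \<open>k\<close> would read
      0 < 0.\<close>
    then have "u \<noteq> 0" using u by force
    have "k \<bullet> sgn u \<le> inverse (real (Suc n))" if "k \<in> K" for k
      using u[OF that] \<open>u \<noteq> 0\<close> by (simp add: sgn_div_norm divide_simps mult.commute)
    with \<open>u \<noteq> 0\<close> show ?thesis by (intro exI[of _ "sgn u"]) (auto simp: norm_sgn)
  qed
  then have "\<exists>u. \<forall>n. norm (u n) = 1 \<and> (\<forall>k\<in>K. k \<bullet> u n \<le> inverse (real (Suc n)))"
    by (intro choice) blast
  then obtain u where u: "\<And>n. norm (u n) = 1"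
    and le: "\<And>n k. k \<in> K \<Longrightarrow> k \<bullet> u n \<le> inverse (real (Suc n))" by blast
  have uS: "u n \<in> sphere 0 1" for n using u by simp
  obtain l r where l: "l \<in> sphere 0 1" "strict_mono r" and lim: "(\<lambda>n. u (r n)) \<longlonglongrightarrow> l"
    by (rule compact_subsequence[of "sphere 0 1" u, OF compact_sphere uS])
  have tr: "(\<lambda>n. inverse (real (Suc (r n)))) \<longlonglongrightarrow> 0"
    using LIMSEQ_subseq_LIMSEQ[OF LIMSEQ_inverse_real_of_nat l(2)] by (simp add: o_def)
  obtain k where k: "k \<in> K" "0 < k \<bullet> l" using pos l(1) by force
  have "k \<bullet> l \<le> 0"
    by (rule LIMSEQ_le[OF tendsto_inner[OF tendsto_const lim] tr]) (use le k in auto)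
  with k show False by simp
qed

section \<open>Uniform approximation on a compact set\<close>

text \<open>Linear Chebyshev approximation in abstract form: \<open>N c\<close> is the uniform error
  when \<open>a\<close> is approximated on \<open>S\<close> by the function with value
  \<open>- (b s \<bullet> c)\<close> at \<open>s\<close>.\<close>

locale affine_family =
  fixes S :: "'s::metric_space set" and a :: "'s \<Rightarrow> real" and b :: "'s \<Rightarrow> 'c::euclidean_space"
  assumes compact_S: "compact S" and S_ne: "S \<noteq> {}"
    and cont_a: "continuous_on S a" and cont_b: "continuous_on S b"
begin

definition val :: "'s \<Rightarrow> 'c \<Rightarrow> real" where "val s c = a s + b s \<bullet> c"
definition N :: "'c \<Rightarrow> real" where "N c = (SUP s\<in>S. \<bar>val s c\<bar>)"
definition extremal :: "'c \<Rightarrow> 's set" where "extremal c = {s \<in> S. \<bar>val s c\<bar> = N c}"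

lemma continuous_val: "continuous_on S (\<lambda>s. val s c)"
  unfolding val_def by (intro continuous_intros cont_a cont_b)

lemma val_add: "val s (c + d) = val s c + b s \<bullet> d"
  by (simp add: val_def inner_add_right)

lemma attained: "\<exists>s\<in>S. \<bar>val s c\<bar> = N c \<and> (\<forall>s'\<in>S. \<bar>val s' c\<bar> \<le> N c)"
proof -
  obtain s where s: "s \<in> S" "\<And>s'. s' \<in> S \<Longrightarrow> \<bar>val s' c\<bar> \<le> \<bar>val s c\<bar>"
    using continuous_attains_sup[OF compact_S S_ne continuous_on_rabs[OF continuous_val[of c]]] by blast
  then have "N c = \<bar>val s c\<bar>" unfolding N_def by (intro cSup_eq_maximum) auto
  with s show ?thesis by auto
qed

lemma val_le_N: "s \<in> S \<Longrightarrow> \<bar>val s c\<bar> \<le> N c"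
  using attained by blast

lemma N_le: "(\<And>s. s \<in> S \<Longrightarrow> \<bar>val s c\<bar> \<le> B) \<Longrightarrow> N c \<le> B"
  using attained[of c] by metis

lemma extremal_ne: "extremal c \<noteq> {}"
  using attained by (auto simp: extremal_def)

lemma compact_extremal: "compact (extremal c)"
proof -
  have "closedin (top_of_set S) (S \<inter> (\<lambda>s. \<bar>val s c\<bar>) -` {N c})"
    by (intro continuous_closedin_preimage continuous_on_rabs continuous_val) auto
  moreover have "S \<inter> (\<lambda>s. \<bar>val s c\<bar>) -` {N c} = extremal c" by (auto simp: extremal_def)
  ultimately show ?thesis using compact_S closedin_compact by metis
qed

lemma N_lipschitz: "\<exists>B>0. \<forall>c d. N (c + d) \<le> N c + B * norm d"
proof -
  have "bounded (b ` S)" using compact_continuous_image[OF cont_b compact_S] compact_imp_bounded by blast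
  then obtain B where B: "B > 0" "\<And>s. s \<in> S \<Longrightarrow> norm (b s) \<le> B" by (auto simp: bounded_pos)
  have "N (c + d) \<le> N c + B * norm d" for c d
  proof (rule N_le)
    fix s assume s: "s \<in> S"
    have "\<bar>b s \<bullet> d\<bar> \<le> norm (b s) * norm d" by (rule Cauchy_Schwarz_ineq2)
    also have "\<dots> \<le> B * norm d" using B(2)[OF s] by (intro mult_right_mono) auto
    finally show "\<bar>val s (c + d)\<bar> \<le> N c + B * norm d"
      using val_le_N[OF s, of c] by (simp add: val_add)
  qed
  with B(1) show ?thesis by blast
qed

lemma continuous_N: "continuous_on T N"
proof -
  obtain B where B: "B > 0" "\<And>c d. N (c + d) \<le> N c + B * norm d" using N_lipschitz by blast
  have "\<bar>N c - N d\<bar> \<le> B * dist c d" for c d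
    using B(2)[of c "d - c"] B(2)[of d "c - d"] by (simp add: dist_norm norm_minus_commute)
  then have "B-lipschitz_on T N" using B(1) by (intro lipschitz_onI) (auto simp: dist_real_def)
  then show ?thesis by (rule lipschitz_on_continuous_on)
qed

text \<open>Nondegeneracy makes the supremum of \<open>\<bar>b s \<bullet> v\<bar>\<close> positive
  on the unit sphere, so it grows at least linearly in \<open>norm v\<close>. Hence \<open>N\<close>
  is coercive and can be minimised over a ball.\<close>

lemma minimum_exists:
  assumes "\<And>v. v \<noteq> 0 \<Longrightarrow> \<exists>s\<in>S. b s \<bullet> v \<noteq> 0"
  shows "\<exists>c0. \<forall>c. N c0 \<le> N c"
proof -
  \<comment> \<open>With the constant term set to 0, \<open>Z.N v\<close> is the supremum of
    \<open>\<bar>b s \<bullet> v\<bar>\<close>, and continuity and attainment come from the same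
    locale.\<close>
  interpret Z: affine_family S "\<lambda>_. 0" b
    by unfold_locales (use compact_S S_ne cont_b in auto)
  have Zval: "Z.val s c = b s \<bullet> c" for s c by (simp add: Z.val_def)
  obtain e :: 'c where "norm e = 1" using vector_choose_size[of 1] by auto
  then have "sphere (0::'c) 1 \<noteq> {}" by auto
  then obtain m where m: "norm m = 1" "\<And>v. norm v = 1 \<Longrightarrow> Z.N m \<le> Z.N v"
    using continuous_attains_inf[OF compact_sphere, of "0::'c" 1 Z.N] Z.continuous_N by auto
  have "m \<noteq> 0" using m(1) by auto
  then obtain s where "s \<in> S" "b s \<bullet> m \<noteq> 0" using assms by blast
  then have pos: "Z.N m > 0" using Z.val_le_N[of s m] by (auto simp: Zval)
  have coercive: "Z.N m * norm v - N 0 \<le> N v" for v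
  proof (cases "v = 0")
    case True
    then show ?thesis using attained[of 0] by auto
  next
    case False
    obtain s where s: "s \<in> S" "\<bar>b s \<bullet> sgn v\<bar> = Z.N (sgn v)"
      using Z.attained[of "sgn v"] by (auto simp: Zval)
    have "Z.N m * norm v \<le> \<bar>b s \<bullet> sgn v\<bar> * norm v"
      using s m(2)[of "sgn v"] False by (intro mult_right_mono) (auto simp: norm_sgn)
    also have "\<dots> = \<bar>b s \<bullet> v\<bar>" using False by (simp add: sgn_div_norm abs_mult)
    also have "\<dots> \<le> N v + N 0"
      using val_le_N[OF s(1), of v] val_le_N[OF s(1), of 0] by (simp add: val_def)
    finally show ?thesis by simp
  qed
  \<comment> \<open>Beyond this radius coercivity gives \<open>N c\<close> at least
    \<open>N 0\<close>, so the centre of the ball is already as good.\<close>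
  define R where "R = 2 * N 0 / Z.N m"
  have "0 \<le> N 0" using attained[of 0] by auto
  then have R: "0 \<le> R" using pos by (simp add: R_def)
  obtain c0 where c0: "c0 \<in> cball 0 R" "\<And>c. c \<in> cball 0 R \<Longrightarrow> N c0 \<le> N c"
    using continuous_attains_inf[OF compact_cball, of "0::'c" R N] continuous_N R by force
  have "N c0 \<le> N c" for c
  proof (cases "norm c \<le> R")
    case False
    then have "2 * N 0 < Z.N m * norm c" using pos by (simp add: R_def divide_simps mult.commute)
    then have "N 0 \<le> N c" using coercive[of c] by linarith
    then show ?thesis using c0(2)[of 0] R by simp
  qed (use c0 in auto)
  then show ?thesis by blast
qed

text \<open>Move from \<open>c0\<close> to \<open>c0 + t n *\<^sub>R u\<close> and choose a point of
  \<open>S\<close> where the moved function attains its maximum modulus. A limit of these points is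
  extremal at \<open>c0\<close>, and the first-order term of the change survives in the
  limit.\<close>

lemma kolmogorov:
  assumes min: "\<And>c. N c0 \<le> N c"
  shows "\<exists>s\<in>extremal c0. 0 \<le> (val s c0 *\<^sub>R b s) \<bullet> u"
proof -
  define t where "t n = inverse (real (Suc n))" for n
  have t0: "t n > 0" for n by (simp add: t_def)
  have t: "t \<longlonglongrightarrow> 0" unfolding t_def by (rule LIMSEQ_inverse_real_of_nat)
  have "\<forall>n. \<exists>s\<in>S. \<bar>val s (c0 + t n *\<^sub>R u)\<bar> = N (c0 + t n *\<^sub>R u)"
    using attained by blast
  then obtain s where sS: "\<And>n. s n \<in> S" and s: "\<And>n. \<bar>val (s n) (c0 + t n *\<^sub>R u)\<bar> = N (c0 + t n *\<^sub>R u)"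
    by metis
  obtain l r where l: "l \<in> S" "strict_mono r" and lim: "(\<lambda>n. s (r n)) \<longlonglongrightarrow> l"
    by (rule compact_subsequence[of S s, OF compact_S sS])
  have tr: "(\<lambda>n. t (r n)) \<longlonglongrightarrow> 0" using LIMSEQ_subseq_LIMSEQ[OF t l(2)] by (simp add: o_def)
  have limv: "(\<lambda>n. val (s (r n)) c0) \<longlonglongrightarrow> val l c0"
    by (rule continuous_on_tendsto_compose[OF continuous_val lim l(1)]) (use sS in auto)
  have limb: "(\<lambda>n. b (s (r n))) \<longlonglongrightarrow> b l"
    by (rule continuous_on_tendsto_compose[OF cont_b lim l(1)]) (use sS in auto)
  have ge: "N c0 \<le> \<bar>val (s n) c0 + t n * (b (s n) \<bullet> u)\<bar>" for n
    using s[of n] min by (simp add: val_add)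
  have "(\<lambda>n. \<bar>val (s (r n)) c0 + t (r n) * (b (s (r n)) \<bullet> u)\<bar>) \<longlonglongrightarrow> \<bar>val l c0 + 0 * (b l \<bullet> u)\<bar>"
    by (intro tendsto_intros limv limb tr)
  then have "N c0 \<le> \<bar>val l c0 + 0 * (b l \<bullet> u)\<bar>"
    by (rule LIMSEQ_le_const) (use ge in auto)
  then have ext: "l \<in> extremal c0" using val_le_N[OF l(1), of c0] l(1) by (simp add: extremal_def)
  \<comment> \<open>The modulus at \<open>s n\<close> does not decrease under the move. Comparing
    squares avoids a case split on signs, and one factor \<open>t n\<close> can be divided
    out.\<close>
  have "0 \<le> 2 * val (s n) c0 * (b (s n) \<bullet> u) + t n * (b (s n) \<bullet> u)\<^sup>2" for n
  proof -
    have "\<bar>val (s n) c0\<bar> \<le> \<bar>val (s n) c0 + t n * (b (s n) \<bullet> u)\<bar>"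
      using ge[of n] val_le_N[OF sS, of n c0] by linarith
    then have "(val (s n) c0)\<^sup>2 \<le> (val (s n) c0 + t n * (b (s n) \<bullet> u))\<^sup>2"
      by (simp add: abs_le_square_iff)
    then have "0 \<le> t n * (2 * val (s n) c0 * (b (s n) \<bullet> u) + t n * (b (s n) \<bullet> u)\<^sup>2)"
      by (simp add: power2_eq_square algebra_simps)
    then show ?thesis using t0[of n] by (simp add: zero_le_mult_iff)
  qed
  moreover have "(\<lambda>n. 2 * val (s (r n)) c0 * (b (s (r n)) \<bullet> u) + t (r n) * (b (s (r n)) \<bullet> u)\<^sup>2)
     \<longlonglongrightarrow> 2 * val l c0 * (b l \<bullet> u) + 0 * (b l \<bullet> u)\<^sup>2"
    by (intro tendsto_intros limv limb tr)
  ultimately have "0 \<le> 2 * val l c0 * (b l \<bullet> u) + 0 * (b l \<bullet> u)\<^sup>2"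
    using LIMSEQ_le_const by blast
  then have "0 \<le> (val l c0 *\<^sub>R b l) \<bullet> u" by (simp add: mult.commute)
  with ext show ?thesis by blast
qed

lemma compact_signatures: "compact ((\<lambda>s. val s c *\<^sub>R b s) ` extremal c)"
  by (intro compact_continuous_image compact_extremal continuous_on_scaleR
      continuous_on_subset[OF continuous_val] continuous_on_subset[OF cont_b])
    (auto simp: extremal_def)

text \<open>By compactness some extremal \<open>s\<close> gives a gain linear in
  \<open>norm u\<close>. The vectors carry the factor \<open>val s c0\<close>, of modulus
  \<open>N c0\<close>, hence the constant \<open>r / N c0\<close>.\<close>

lemma strongly_unique:
  assumes pos: "N c0 > 0"
    and ex: "\<And>u. norm u = 1 \<Longrightarrow> \<exists>s\<in>extremal c0. 0 < (val s c0 *\<^sub>R b s) \<bullet> u"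
  shows "\<exists>r>0. \<forall>u. N c0 + r * norm u \<le> N (c0 + u)"
proof -
  obtain r where r: "r > 0"
    and ru: "\<And>u. \<exists>s\<in>extremal c0. r * norm u \<le> (val s c0 *\<^sub>R b s) \<bullet> u"
    using compact_support_pos[OF compact_signatures[of c0]] ex by auto
  have "N c0 + r / N c0 * norm u \<le> N (c0 + u)" for u
  proof -
    obtain s where s: "s \<in> extremal c0" "r * norm u \<le> val s c0 * (b s \<bullet> u)"
      using ru[of u] by auto
    have e: "\<bar>val s c0\<bar> = N c0" "s \<in> S" using s by (auto simp: extremal_def)
    \<comment> \<open>After multiplication by \<open>N c0\<close> the first term is the square of
      \<open>val s c0\<close>, so the sign of \<open>val s c0\<close> need not be known.\<close>
    have "N c0 * (N c0 + r / N c0 * norm u) = val s c0 * val s c0 + r * norm u"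
      using pos e(1) abs_mult_self_eq[of "val s c0"] by (simp add: field_simps)
    also have "\<dots> \<le> val s c0 * val s (c0 + u)" using s(2) by (simp add: val_add algebra_simps)
    also have "\<dots> \<le> \<bar>val s c0\<bar> * \<bar>val s (c0 + u)\<bar>"
      by (metis abs_ge_self abs_mult)
    also have "\<dots> \<le> N c0 * N (c0 + u)"
      using e val_le_N pos by (intro mult_mono) auto
    finally show ?thesis using pos by simp
  qed
  with r pos show ?thesis by (intro exI[of _ "r / N c0"]) auto
qed

end

section \<open>Planar geometry\<close>

text \<open>The vectors orthogonal to \<open>v\<close> form the line spanned by its quarter
  turn.\<close>

lemma orthogonal_pair_real2:
  fixes k v :: "real \<times> real"
  assumes "norm v = 1" "k \<bullet> v = 0"
  shows "k = (k \<bullet> (- snd v, fst v)) *\<^sub>R (- snd v, fst v)"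
proof -
  have n: "(fst v)\<^sup>2 + (snd v)\<^sup>2 = 1" using assms(1) by (simp add: norm_prod_def real_sqrt_eq_1_iff)
  have o: "fst k * fst v + snd k * snd v = 0" using assms(2) by (simp add: inner_prod_def)
  have "fst k = fst k * ((fst v)\<^sup>2 + (snd v)\<^sup>2)" "snd k = snd k * ((fst v)\<^sup>2 + (snd v)\<^sup>2)"
    using n by simp_all
  moreover have "fst k * ((fst v)\<^sup>2 + (snd v)\<^sup>2) = (fst k * - snd v + snd k * fst v) * - snd v"
    using o by algebra
  moreover have "snd k * ((fst v)\<^sup>2 + (snd v)\<^sup>2) = (fst k * - snd v + snd k * fst v) * fst v"
    using o by algebra
  ultimately show ?thesis by (simp add: prod_eq_iff inner_prod_def)
qed

text \<open>\<open>K\<close> lies in a closed half plane but in no open one, so it touches the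
  boundary. In the plane the boundary is a line, and tilting towards either end of that line yields
  a point of \<open>K\<close> on each side of 0.\<close>

lemma opposite_pair:
  fixes K :: "(real \<times> real) set"
  assumes "compact K" and pos: "\<And>u. \<exists>k\<in>K. 0 \<le> k \<bullet> u" and "0 \<notin> K"
    and v: "norm v = 1" "\<And>k. k \<in> K \<Longrightarrow> k \<bullet> v \<le> 0"
  shows "\<exists>k1\<in>K. \<exists>k2\<in>K. \<exists>\<tau>>0. k1 + \<tau> *\<^sub>R k2 = 0"
proof -
  define w where "w = (- snd v, fst v)"
  obtain k1 where k1: "k1 \<in> K" "k1 \<bullet> v = 0" "0 \<le> k1 \<bullet> w"
    using compact_support_zero[OF assms(1) pos v(2), of w] by blast
  obtain k2 where k2: "k2 \<in> K" "k2 \<bullet> v = 0" "0 \<le> k2 \<bullet> (- w)"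
    using compact_support_zero[OF assms(1) pos v(2), of "- w"] by blast
  have e: "k1 = (k1 \<bullet> w) *\<^sub>R w" "k2 = (k2 \<bullet> w) *\<^sub>R w"
    using orthogonal_pair_real2[OF v(1)] k1(2) k2(2) by (simp_all add: w_def)
  have "k1 \<bullet> w \<noteq> 0" using e(1) k1(1) \<open>0 \<notin> K\<close> by auto
  moreover have "k2 \<bullet> w \<noteq> 0" using e(2) k2(1) \<open>0 \<notin> K\<close> by auto
  ultimately have s: "k1 \<bullet> w > 0" "k2 \<bullet> w < 0" using k1(3) k2(3) by auto
  define \<tau> where "\<tau> = (k1 \<bullet> w) / - (k2 \<bullet> w)"
  have "\<tau> > 0" using s by (simp add: \<tau>_def divide_pos_neg)
  moreover have "k1 + \<tau> *\<^sub>R k2 = (k1 \<bullet> w + \<tau> * (k2 \<bullet> w)) *\<^sub>R w"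
    by (subst (1) e(1), subst (1) e(2)) (simp add: scaleR_add_left)
  then have "k1 + \<tau> *\<^sub>R k2 = 0" using s by (simp add: \<tau>_def)
  ultimately show ?thesis using k1(1) k2(1) by blast
qed

section \<open>Euclidean coordinates and the numerical radius\<close>

lemma linear_inj_bounded_below_euclidean:
  fixes P :: "'e::euclidean_space \<Rightarrow> 'a::real_normed_vector"
  assumes "linear P" "inj P"
  shows "\<exists>m>0. \<forall>x. m * norm x \<le> norm (P x)"
proof -
  have bl: "bounded_linear P" using assms(1) by (simp add: linear_conv_bounded_linear)
  obtain e :: 'e where "norm e = 1" using vector_choose_size[of 1] by auto
  then have "sphere (0::'e) 1 \<noteq> {}" by auto
  then obtain x0 where x0: "norm x0 = 1" "\<And>x. norm x = 1 \<Longrightarrow> norm (P x0) \<le> norm (P x)"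
    using continuous_attains_inf[OF compact_sphere, of "0::'e" 1 "\<lambda>x. norm (P x)"]
      continuous_on_norm[OF linear_continuous_on[OF bl]] by auto
  have "P x0 \<noteq> 0" using x0(1) assms linear_injective_0 by fastforce
  moreover have "norm (P x0) * norm x \<le> norm (P x)" for x
  proof (cases "x = 0")
    case False
    have "norm (P x0) * norm x \<le> norm (P (sgn x)) * norm x"
      using x0(2)[of "sgn x"] False by (intro mult_right_mono) (auto simp: norm_sgn)
    also have "\<dots> = norm (P x)"
      using False by (simp add: sgn_div_norm linear_cmul[OF assms(1)])
    finally show ?thesis .
  qed simp
  ultimately show ?thesis by (intro exI[of _ "norm (P x0)"]) auto
qed

text \<open>A linear bijection from a Euclidean space gives access to inner products and
  compactness, while the norm of \<open>'a\<close> enters only as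
  \<open>norm (P \<xi>)\<close>.\<close>

locale coordinates =
  fixes P :: "'e::euclidean_space \<Rightarrow> 'a::real_normed_vector"
  assumes linear_P: "linear P" and bij_P: "bij P"
begin

definition R :: "'a \<Rightarrow> 'e" where "R = inv P"

text \<open>A pair (\<open>\<xi>\<close>, \<open>y\<close>) encodes the point \<open>P \<xi>\<close> and the functional \<open>P \<eta> \<mapsto> y \<bullet> \<eta>\<close>.\<close>
definition states :: "('e \<times> 'e) set" where
  "states = {(\<xi>, y). norm (P \<xi>) = 1 \<and> (\<forall>\<eta>. \<bar>y \<bullet> \<eta>\<bar> \<le> norm (P \<eta>)) \<and> y \<bullet> \<xi> = 1}"

lemma R_P [simp]: "R (P \<xi>) = \<xi>"
  using bij_P by (simp add: R_def bij_is_inj)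

lemma P_R [simp]: "P (R x) = x"
  using bij_P by (simp add: R_def bij_is_surj surj_f_inv_f)

lemma bounded_linear_P: "bounded_linear P"
  using linear_P by (simp add: linear_conv_bounded_linear)

lemma linear_R: "linear R"
proof (rule linearI)
  show "R (x + y) = R x + R y" for x y
    using R_P[of "R x + R y"] by (simp add: linear_add[OF linear_P])
  show "R (c *\<^sub>R x) = c *\<^sub>R R x" for c x
    using R_P[of "c *\<^sub>R R x"] by (simp add: linear_cmul[OF linear_P])
qed

lemma bounded_linear_R: "bounded_linear R"
proof -
  obtain m where m: "m > 0" "\<And>\<xi>. m * norm \<xi> \<le> norm (P \<xi>)"
    using linear_inj_bounded_below_euclidean[OF linear_P bij_is_inj[OF bij_P]] by blast
  have "norm (R x) \<le> norm x * (1 / m)" for x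
    using m(2)[of "R x"] m(1) by (simp add: field_simps)
  then show ?thesis
    using linear_R unfolding bounded_linear_def bounded_linear_axioms_def by blast
qed

lemma bounded_linear_of_linear: "linear f \<Longrightarrow> bounded_linear f" for f :: "'a \<Rightarrow> 'b::real_normed_vector"
proof -
  assume f: "linear f"
  have "linear (\<lambda>\<xi>. f (P \<xi>))" using linear_compose[OF linear_P f] by (simp add: o_def)
  then have "bounded_linear (\<lambda>\<xi>. f (P \<xi>))" by (simp add: linear_conv_bounded_linear)
  from bounded_linear_compose[OF this bounded_linear_R] show "bounded_linear f" by simp
qed

text \<open>The lower bound for \<open>P\<close> controls the points, and testing a functional
  \<open>y\<close> on \<open>P y\<close> controls \<open>y\<close>. Every defining condition is
  closed.\<close>

lemma compact_states: "compact states"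
proof -
  obtain m where m: "m > 0" "\<And>\<xi>. m * norm \<xi> \<le> norm (P \<xi>)"
    using linear_inj_bounded_below_euclidean[OF linear_P bij_is_inj[OF bij_P]] by blast
  obtain B where B: "B > 0" "\<And>\<xi>. norm (P \<xi>) \<le> norm \<xi> * B"
    using bounded_linear.pos_bounded[OF bounded_linear_P] by blast
  have "norm \<xi> \<le> 1 / m" if "(\<xi>, y) \<in> states" for \<xi> y
    using that m(2)[of \<xi>] m(1) by (simp add: states_def field_simps)
  moreover have "norm y \<le> B" if "(\<xi>, y) \<in> states" for \<xi> y
  proof (cases "y = 0")
    case False
    have "norm y * norm y = \<bar>y \<bullet> y\<bar>" by (simp add: dot_square_norm power2_eq_square)
    also have "\<dots> \<le> norm (P y)" using that unfolding states_def by blast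
    also have "\<dots> \<le> norm y * B" by (rule B(2))
    finally show ?thesis using False by simp
  qed (use B in auto)
  ultimately have "states \<subseteq> cball 0 (1 / m) \<times> cball 0 B" by auto
  then have "bounded states" using bounded_Times[OF bounded_cball bounded_cball] bounded_subset by blast
  moreover have "states = {p. norm (P (fst p)) = 1} \<inter> (\<Inter>\<eta>. {p. \<bar>snd p \<bullet> \<eta>\<bar> \<le> norm (P \<eta>)})
      \<inter> {p. snd p \<bullet> fst p = 1}"
    by (auto simp: states_def)
  then have "closed states"
    by (auto intro!: closed_Int closed_INT closed_Collect_eq closed_Collect_le continuous_intros
      linear_continuous_on_compose[OF _ linear_P] bounded_linear.continuous_on[OF bounded_linear_P])
  ultimately show ?thesis by (simp add: compact_eq_bounded_closed)
qed

text \<open>The value 1 at the unit vector \<open>x\<close> already forces norm at least 1, so only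
  the upper bound remains, which is the condition used in \<open>states\<close>.\<close>

lemma onorm_eq_1_iff:
  fixes f :: "'a \<Rightarrow> real"
  assumes "norm x = 1" "f x = 1"
  shows "bounded_linear f \<and> onorm f = 1 \<longleftrightarrow> linear f \<and> (\<forall>u. \<bar>f u\<bar> \<le> norm u)"
proof
  assume "bounded_linear f \<and> onorm f = 1"
  then show "linear f \<and> (\<forall>u. \<bar>f u\<bar> \<le> norm u)"
    using onorm[of f] by (auto simp: bounded_linear.linear)
next
  assume f: "linear f \<and> (\<forall>u. \<bar>f u\<bar> \<le> norm u)"
  then have bl: "bounded_linear f" using bounded_linear_of_linear by blast
  have "onorm f \<le> 1" by (rule onorm_bound) (use f in auto)
  moreover have "1 \<le> onorm f" using onorm[OF bl, of x] assms by simp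
  ultimately show "bounded_linear f \<and> onorm f = 1" using bl by simp
qed

text \<open>Points correspond through \<open>P\<close> and \<open>R\<close>, functionals through
  their Riesz vectors in the coordinate space.\<close>

lemma numrad_states: "numrad T = (SUP (\<xi>, y)\<in>states. \<bar>y \<bullet> R (T (P \<xi>))\<bar>)"
proof -
  have "{\<bar>f (T x)\<bar> | x f. norm x = 1 \<and> bounded_linear f \<and> onorm f = 1 \<and> f x = 1}
      = (\<lambda>(\<xi>, y). \<bar>y \<bullet> R (T (P \<xi>))\<bar>) ` states" (is "?A = ?B")
  proof (intro set_eqI iffI)
    fix r assume "r \<in> ?A"
    then obtain x f where r: "r = \<bar>f (T x)\<bar>" and x: "norm x = 1" "f x = 1"
      and f: "bounded_linear f \<and> onorm f = 1" by blast
    have f: "linear f" "\<And>u. \<bar>f u\<bar> \<le> norm u" using onorm_eq_1_iff[of x f, OF x] f by auto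
    \<comment> \<open>The Riesz vector of the functional \<open>f\<close> composed with
      \<open>P\<close>.\<close>
    define y where "y = (\<Sum>e\<in>Basis. f (P e) *\<^sub>R e)"
    have y: "y \<bullet> \<eta> = f (P \<eta>)" for \<eta>
    proof -
      have lin: "linear (\<lambda>\<xi>. f (P \<xi>))" using linear_compose[OF linear_P f(1)] by (simp add: o_def)
      have "f (P \<eta>) = f (P (\<Sum>e\<in>Basis. (\<eta> \<bullet> e) *\<^sub>R e))" by (simp add: euclidean_representation)
      also have "\<dots> = (\<Sum>e\<in>Basis. f (P ((\<eta> \<bullet> e) *\<^sub>R e)))" by (rule linear_sum[OF lin])
      also have "\<dots> = y \<bullet> \<eta>"
        by (simp add: y_def inner_sum_left linear_cmul[OF lin] inner_commute[of \<eta>] mult.commute)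
      finally show ?thesis by simp
    qed
    have "(R x, y) \<in> states" using x f(2) by (simp add: states_def y)
    moreover have "r = \<bar>y \<bullet> R (T (P (R x)))\<bar>" by (simp add: r y)
    ultimately show "r \<in> ?B" by force
  next
    fix r assume "r \<in> ?B"
    then obtain \<xi> y where s: "(\<xi>, y) \<in> states" and r: "r = \<bar>y \<bullet> R (T (P \<xi>))\<bar>" by auto
    define f where "f x = y \<bullet> R x" for x
    have x: "norm (P \<xi>) = 1" "f (P \<xi>) = 1" using s by (auto simp: states_def f_def)
    have "linear f" unfolding f_def 
      by (intro bounded_linear.linear bounded_linear_compose[OF bounded_linear_inner_right bounded_linear_R])
    moreover have "\<bar>f u\<bar> \<le> norm u" for u
      using s by (auto simp: states_def f_def dest: spec[of _ "R u"])
    ultimately have "bounded_linear f \<and> onorm f = 1" using onorm_eq_1_iff[of "P \<xi>" f, OF x] by blast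
    with x show "r \<in> ?A" unfolding r f_def[symmetric] by blast
  qed
  then show ?thesis by (simp add: numrad_def)
qed

text \<open>The Hahn-Banach support functional, obtained by separating the open unit ball in
  coordinates from \<open>\<xi>\<close> and normalising.\<close>

lemma support_exists:
  assumes "norm (P \<xi>) = 1"
  shows "\<exists>y. (\<xi>, y) \<in> states"
proof -
  define B where "B = {\<eta>. norm (P \<eta>) < 1}"
  have "B = P -` ball 0 1" by (auto simp: B_def)
  then have "convex B" using convex_linear_vimage[OF linear_P convex_ball] by simp
  moreover have "0 \<in> B" using linear_0[OF linear_P] by (simp add: B_def)
  moreover have "B \<inter> {\<xi>} = {}" using assms by (auto simp: B_def)
  ultimately obtain a \<beta> where a: "a \<noteq> 0" "\<And>\<eta>. \<eta> \<in> B \<Longrightarrow> a \<bullet> \<eta> \<le> \<beta>" "a \<bullet> \<xi> \<ge> \<beta>"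
    using separating_hyperplane_sets[of B "{\<xi>}"] by auto
  have scaled: "a \<bullet> \<eta> \<le> \<beta> * norm (P \<eta>)" for \<eta>
  proof (rule field_le_epsilon)
    fix e :: real assume "e > 0"
    have "0 \<le> \<beta>" using a(2)[OF \<open>0 \<in> B\<close>] by simp
    \<comment> \<open>The slack \<open>d\<close> brings the rescaled vector strictly inside the unit
      ball, even when \<open>P \<eta> = 0\<close>. The denominator is \<open>\<beta> + 1\<close>
      because \<open>\<beta>\<close> is so far only known to be nonnegative.\<close>
    define d where "d = e / (\<beta> + 1)"
    have d: "d > 0" "\<beta> * d \<le> e" using \<open>e > 0\<close> \<open>0 \<le> \<beta>\<close> by (auto simp: d_def field_simps)
    define q where "q = norm (P \<eta>) + d"
    have q: "q > 0" using d(1) by (simp add: q_def add_nonneg_pos)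
    have "norm (P ((1 / q) *\<^sub>R \<eta>)) < 1"
      using q d(1) by (simp add: linear_cmul[OF linear_P] q_def)
    then have "a \<bullet> ((1 / q) *\<^sub>R \<eta>) \<le> \<beta>" using a(2)[of "(1 / q) *\<^sub>R \<eta>"] unfolding B_def by blast
    then have "a \<bullet> \<eta> \<le> \<beta> * q" using q by (simp add: field_simps)
    also have "\<dots> \<le> \<beta> * norm (P \<eta>) + e" using d(2) by (simp add: q_def algebra_simps)
    finally show "a \<bullet> \<eta> \<le> \<beta> * norm (P \<eta>) + e" .
  qed
  have "0 < a \<bullet> a" using a(1) by simp
  then have "0 < \<beta> * norm (P a)" using scaled[of a] by linarith
  then have "\<beta> \<noteq> 0" by auto
  then have \<beta>: "\<beta> > 0" using a(2)[OF \<open>0 \<in> B\<close>] by simp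
  have abs: "\<bar>a \<bullet> \<eta>\<bar> \<le> \<beta> * norm (P \<eta>)" for \<eta>
    using scaled[of \<eta>] scaled[of "- \<eta>"] by (simp add: linear_neg[OF linear_P])
  have "a \<bullet> \<xi> = \<beta>" using scaled[of \<xi>] a(3) assms by simp
  then have "(\<xi>, (1 / \<beta>) *\<^sub>R a) \<in> states"
    using assms abs \<beta> by (simp add: states_def abs_mult field_simps)
  then show ?thesis by blast
qed

lemma states_ne: "states \<noteq> {}"
proof -
  obtain e :: 'e where "norm e = 1" using vector_choose_size[of 1] by auto
  then have "P e \<noteq> 0" using bij_P linear_P linear_injective_0 bij_is_inj by fastforce
  then have "norm (P (R (sgn (P e)))) = 1" by (simp add: norm_sgn)
  then show ?thesis using support_exists by blast
qed

end

section \<open>Extensions of A as an affine family\<close>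

locale extension_coordinates = coordinates P
  for P :: "'c::euclidean_space \<times> real \<Rightarrow> 'a::real_normed_vector" +
  fixes V :: "'a set" and A :: "'a \<Rightarrow> 'a"
  assumes V_eq: "V = range (\<lambda>d. P (d, 0))" and A_BV: "A \<in> BV V"
begin

definition M :: "'c \<Rightarrow> 'c" where "M d = fst (R (A (P (d, 0))))"

text \<open>\<open>c\<close> gives the coordinates of the image of \<open>P (0, 1)\<close>, a vector
  outside \<open>V\<close>; on \<open>V\<close> the map agrees with \<open>A\<close>.\<close>

definition ext :: "'c \<Rightarrow> 'a \<Rightarrow> 'a" where
  "ext c x = P (M (fst (R x)) + snd (R x) *\<^sub>R c, 0)"

text \<open>The elements of \<open>BVXV V\<close>, parametrised by the image of
  \<open>P (0, 1)\<close>; \<open>ext_diff_rank1\<close> shows that subtracting one shifts the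
  parameter of \<open>ext\<close>.\<close>

definition rank1 :: "'c \<Rightarrow> 'a \<Rightarrow> 'a" where
  "rank1 u x = P (snd (R x) *\<^sub>R u, 0)"

text \<open>\<open>base\<close> and \<open>slope\<close> are the constant term and the coefficient
  of \<open>c\<close> when the functional of a state is applied to the image of its point under
  \<open>ext c\<close>.\<close>

definition base :: "('c \<times> real) \<times> ('c \<times> real) \<Rightarrow> real" where
  "base s = fst (snd s) \<bullet> M (fst (fst s))"

definition slope :: "('c \<times> real) \<times> ('c \<times> real) \<Rightarrow> 'c" where
  "slope s = snd (fst s) *\<^sub>R fst (snd s)"

lemma P_in_V [simp]: "P (d, 0) \<in> V"
  by (auto simp: V_eq)

lemma V_D: "v \<in> V \<Longrightarrow> v = P (fst (R v), 0)"
  by (auto simp: V_eq)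

lemma snd_R_V: "v \<in> V \<Longrightarrow> snd (R v) = 0"
  by (auto simp: V_eq)

lemma A_add: "v \<in> V \<Longrightarrow> w \<in> V \<Longrightarrow> A (v + w) = A v + A w"
  and A_scale: "v \<in> V \<Longrightarrow> A (c *\<^sub>R v) = c *\<^sub>R A v"
  and A_V: "v \<in> V \<Longrightarrow> A v \<in> V"
  using A_BV by (auto simp: BV_def linear_on_sub_def)

lemma A_P: "A (P (d, 0)) = P (M d, 0)"
  unfolding M_def by (rule V_D) (simp add: A_V)

lemma linear_M: "linear M"
proof (rule linearI)
  fix d e :: 'c and c :: real
  have "P (d + e, 0) = P (d, 0) + P (e, 0)"
    using linear_add[OF linear_P, of "(d, 0)" "(e, 0)"] by simp
  then show "M (d + e) = M d + M e"
    by (simp add: M_def A_add linear_add[OF linear_R])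
  have "P (c *\<^sub>R d, 0) = c *\<^sub>R P (d, 0)"
    using linear_cmul[OF linear_P, of c "(d, 0)"] by simp
  then show "M (c *\<^sub>R d) = c *\<^sub>R M d"
    by (simp add: M_def A_scale linear_cmul[OF linear_R])
qed

lemma linear_P_fst: "linear (\<lambda>d. P (d, 0))"
proof (rule linearI)
  show "P (d + e, 0) = P (d, 0) + P (e, 0)" for d e
    using linear_add[OF linear_P, of "(d, 0)" "(e, 0)"] by simp
  show "P (c *\<^sub>R d, 0) = c *\<^sub>R P (d, 0)" for c d
    using linear_cmul[OF linear_P, of c "(d, 0)"] by simp
qed

lemma linear_ext: "linear (ext c)"
  unfolding ext_def
  by (rule linearI)
    (simp_all add: linear_add[OF linear_R] linear_cmul[OF linear_R] linear_add[OF linear_M]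
      linear_cmul[OF linear_M] scaleR_add_left
      linear_add[OF linear_P_fst, symmetric] linear_cmul[OF linear_P_fst, symmetric] algebra_simps)

lemma ext_eq_A: "v \<in> V \<Longrightarrow> ext c v = A v"
  using A_P[of "fst (R v)"] V_D[of v] by (simp add: ext_def snd_R_V)

lemma ext_extension: "ext c \<in> extensions V A"
  using linear_ext ext_eq_A by (auto simp: extensions_def BXV_def ext_def)

lemma decompose: "x = P (fst (R x), 0) + snd (R x) *\<^sub>R P (0, 1)"
  using linear_add[OF linear_P, of "(fst (R x), 0)" "snd (R x) *\<^sub>R (0, 1)"]
  by (simp add: linear_cmul[OF linear_P, symmetric])

text \<open>An extension is prescribed on \<open>V\<close>, so it is determined by the image of
  \<open>P (0, 1)\<close>, which lies in \<open>V\<close>.\<close>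

lemma extension_ext:
  assumes "B \<in> extensions V A"
  shows "\<exists>c. B = ext c"
proof -
  have lin: "linear B" and BV: "B x \<in> V" and BA: "v \<in> V \<Longrightarrow> B v = A v" for x v
    using assms by (auto simp: extensions_def BXV_def)
  define c where "c = fst (R (B (P (0, 1))))"
  have c: "B (P (0, 1)) = P (c, 0)" unfolding c_def by (rule V_D) (rule BV)
  have "B x = ext c x" for x
  proof -
    have "B x = B (P (fst (R x), 0) + snd (R x) *\<^sub>R P (0, 1))" using decompose by simp
    also have "\<dots> = P (M (fst (R x)), 0) + snd (R x) *\<^sub>R P (c, 0)"
      by (simp add: linear_add[OF lin] linear_cmul[OF lin] c BA A_P)
    also have "\<dots> = ext c x"
      by (simp add: ext_def linear_add[OF linear_P_fst] linear_cmul[OF linear_P_fst])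
    finally show ?thesis .
  qed
  then show ?thesis by blast
qed

lemma BVXV_rank1:
  assumes "L \<in> BVXV V"
  shows "\<exists>u. L = rank1 u"
proof -
  have lin: "linear L" and LV: "L x \<in> V" and L0: "v \<in> V \<Longrightarrow> L v = 0" for x v
    using assms by (auto simp: BVXV_def BXV_def)
  define c where "c = fst (R (L (P (0, 1))))"
  have c: "L (P (0, 1)) = P (c, 0)" unfolding c_def by (rule V_D) (rule LV)
  have "L x = rank1 c x" for x
  proof -
    have "L x = L (P (fst (R x), 0) + snd (R x) *\<^sub>R P (0, 1))" using decompose by simp
    also have "\<dots> = rank1 c x"
      by (simp add: linear_add[OF lin] linear_cmul[OF lin] c L0 rank1_def linear_cmul[OF linear_P_fst])
    finally show ?thesis .
  qed
  then show ?thesis by blast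
qed

lemma ext_diff_rank1: "ext c x - rank1 u x = ext (c - u) x"
  by (simp add: ext_def rank1_def linear_diff[OF linear_P_fst, symmetric] algebra_simps)

sublocale affine_family states base slope
proof
  have "continuous_on UNIV M"
    using linear_M by (simp add: linear_continuous_on linear_conv_bounded_linear)
  then have "continuous_on states (\<lambda>s. M (fst (fst s)))"
    by (rule continuous_on_compose2)
      (auto intro!: continuous_on_fst continuous_on_id)
  then show "continuous_on states base"
    unfolding base_def
    by (intro continuous_on_inner continuous_on_fst continuous_on_snd continuous_on_id)
  show "continuous_on states slope"
    unfolding slope_def
    by (intro continuous_on_scaleR continuous_on_fst continuous_on_snd continuous_on_id)
qed (rule compact_states, rule states_ne)

lemma numrad_ext: "numrad (ext c) = N c"
proof -
  have "(\<lambda>(\<xi>, y). \<bar>y \<bullet> R (ext c (P \<xi>))\<bar>) = (\<lambda>s. \<bar>val s c\<bar>)"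
    by (auto simp: fun_eq_iff ext_def val_def base_def slope_def inner_prod_def inner_add_right)
  then show ?thesis by (simp add: numrad_states N_def)
qed

text \<open>Needed to turn a gain in \<open>norm u\<close> into a gain in the numerical radius of
  the corresponding operator.\<close>

lemma numrad_rank1_le: "\<exists>B>0. \<forall>u. numrad (rank1 u) \<le> B * norm u"
proof -
  interpret Z: affine_family states "\<lambda>_. 0" slope
    by unfold_locales (use compact_S S_ne cont_b in auto)
  have "(\<lambda>(\<xi>, y). \<bar>y \<bullet> R (rank1 u (P \<xi>))\<bar>) = (\<lambda>s. \<bar>Z.val s u\<bar>)" for u
    by (auto simp: fun_eq_iff rank1_def Z.val_def slope_def inner_prod_def)
  then have eq: "numrad (rank1 u) = Z.N u" for u by (simp add: numrad_states Z.N_def)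
  obtain B where B: "B > 0" "\<And>c d. Z.N (c + d) \<le> Z.N c + B * norm d" using Z.N_lipschitz by blast
  have "Z.N 0 \<le> 0" by (rule Z.N_le) (simp add: Z.val_def)
  then have "numrad (rank1 u) \<le> B * norm u" for u using B(2)[of 0 u] by (simp add: eq)
  with B(1) show ?thesis by blast
qed

text \<open>Support the unit ball at the direction of a vector \<open>x\<close> whose
  \<open>V\<close> component is a large multiple of \<open>P (v, 0)\<close>. If the functional
  vanished on \<open>P (v, 0)\<close>, it would take the value \<open>norm x\<close> on
  \<open>P (0, 1)\<close>, too much for a functional of norm at most 1.\<close>

lemma slope_nondegenerate:
  assumes "v \<noteq> 0"
  shows "\<exists>s\<in>states. slope s \<bullet> v \<noteq> 0"
proof -
  define p where "p = norm (P (0, 1))"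
  define n where "n = norm (P (v, 0))"
  have "P (v, 0) \<noteq> 0" using assms R_P[of "(v, 0)"] linear_0[OF linear_R] by (metis fst_conv fst_zero)
  then have n: "n > 0" by (simp add: n_def)
  \<comment> \<open>This makes the \<open>V\<close> component of \<open>x\<close> have norm
    \<open>2 * p + 1\<close>, so \<open>norm x\<close> is at least \<open>p + 1\<close>.\<close>
  define t where "t = (2 * p + 1) / n"
  define x where "x = P (t *\<^sub>R v, 1)"
  have x: "x = t *\<^sub>R P (v, 0) + P (0, 1)"
    using linear_add[OF linear_P, of "t *\<^sub>R (v, 0)" "(0, 1)"]
    by (simp add: x_def linear_cmul[OF linear_P, symmetric])
  have "norm (t *\<^sub>R P (v, 0)) \<le> norm x + p"
    using norm_triangle_ineq4[of x "P (0, 1)"] by (simp add: x p_def)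
  moreover have "norm (t *\<^sub>R P (v, 0)) = 2 * p + 1"
    using n by (simp add: n_def[symmetric] t_def p_def)
  ultimately have xp: "norm x > p" by linarith
  then have x0: "norm x > 0" by (smt (verit) p_def norm_ge_zero)
  define \<xi> where "\<xi> = (1 / norm x) *\<^sub>R (t *\<^sub>R v, 1::real)"
  have "P \<xi> = (1 / norm x) *\<^sub>R x" unfolding \<xi>_def x_def by (rule linear_cmul[OF linear_P])
  then have "norm (P \<xi>) = 1" using x0 by simp
  then obtain y where s: "(\<xi>, y) \<in> states" using support_exists by blast
  have "fst y \<bullet> v \<noteq> 0"
  proof
    assume yv: "fst y \<bullet> v = 0"
    have "y \<bullet> \<xi> = 1" using s by (simp add: states_def)
    then have "snd y / norm x = 1" using yv x0 by (auto simp: \<xi>_def inner_prod_def)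
    then have "snd y = norm x" using x0 by (simp add: field_simps)
    moreover have "\<bar>y \<bullet> (0, 1)\<bar> \<le> p" using s unfolding states_def p_def by blast
    ultimately show False using xp by (simp add: inner_prod_def)
  qed
  moreover have "snd \<xi> \<noteq> 0" using x0 by (simp add: \<xi>_def)
  ultimately show ?thesis using s by (intro bexI[of _ "(\<xi>, y)"]) (auto simp: slope_def)
qed

section \<open>Opposite extremal states and the norm of A\<close>

lemma norm_A_le: "v \<in> V \<Longrightarrow> norm (A v) \<le> opnorm_on V A * norm v"
  and opnorm_nonneg: "0 \<le> opnorm_on V A"
proof -
  let ?S = "{norm (A v) | v. v \<in> V \<and> norm v \<le> 1}"
  \<comment> \<open>The bound for \<open>A\<close> on \<open>V\<close> is inherited from the
    everywhere defined linear map \<open>ext 0\<close>.\<close>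
  obtain K where K: "K > 0" "\<And>x. norm (ext 0 x) \<le> norm x * K"
    using bounded_linear.pos_bounded[OF bounded_linear_of_linear[OF linear_ext]] by blast
  have "norm (A v) \<le> K" if "v \<in> V" "norm v \<le> 1" for v
  proof -
    have "norm (A v) \<le> norm v * K" using K(2)[of v] ext_eq_A[OF that(1)] by simp
    also have "\<dots> \<le> 1 * K" using that(2) K(1) by (intro mult_right_mono) auto
    finally show ?thesis by simp
  qed
  then have "bdd_above ?S" by (auto intro!: bdd_aboveI[of _ K])
  then have le: "norm (A v) \<le> opnorm_on V A" if "v \<in> V" "norm v \<le> 1" for v
    unfolding opnorm_on_def using that by (intro cSup_upper) auto
  have z: "P (0, 0) = 0" using linear_0[OF linear_P_fst] .
  then have "0 \<in> V" using P_in_V[of 0] by simp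
  then show "0 \<le> opnorm_on V A" using order_trans[OF norm_ge_zero le[of 0]] by simp
  show "norm (A v) \<le> opnorm_on V A * norm v" if v: "v \<in> V"
  proof (cases "v = 0")
    case True
    have "A 0 = 0" using A_scale[OF \<open>0 \<in> V\<close>, of 0] by simp
    then show ?thesis by (simp add: True)
  next
    case False
    have "sgn v = P (inverse (norm v) *\<^sub>R fst (R v), 0)"
      using V_D[OF v] by (simp add: sgn_div_norm linear_cmul[OF linear_P_fst])
    then have "sgn v \<in> V" by simp
    then have "norm (A (sgn v)) \<le> opnorm_on V A" by (rule le) (simp add: norm_sgn)
    moreover have "A (sgn v) = inverse (norm v) *\<^sub>R A v"
      using A_scale[OF v] by (simp add: sgn_div_norm)
    ultimately show ?thesis using False by (simp add: field_simps)
  qed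
qed

text \<open>The witness is the combination of \<open>P \<xi>1\<close> and \<open>P \<xi>2\<close> that lies in \<open>V\<close>, tested
  with the functional \<open>y1\<close>; \<open>le\<close> says that \<open>y1\<close> is the one with the larger norm on \<open>V\<close>.\<close>
lemma opposite_states_stretch:
  assumes s1: "(\<xi>1, y1) \<in> extremal c0" and s2: "(\<xi>2, y2) \<in> extremal c0"
    and pos: "N c0 > 0" and "\<tau> > 0" and le: "\<bar>snd \<xi>1\<bar> \<le> \<tau> * \<bar>snd \<xi>2\<bar>"
    and opp: "val (\<xi>1, y1) c0 *\<^sub>R slope (\<xi>1, y1) + \<tau> *\<^sub>R (val (\<xi>2, y2) c0 *\<^sub>R slope (\<xi>2, y2)) = 0"
    and ne: "snd \<xi>2 \<noteq> 0"
  shows "N c0 \<le> opnorm_on V A"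
proof -
  define g1 where "g1 = snd \<xi>1"
  define g2 where "g2 = snd \<xi>2"
  define e1 where "e1 = val (\<xi>1, y1) c0"
  define e2 where "e2 = val (\<xi>2, y2) c0"
  \<comment> \<open>The coordinates in \<open>V\<close> of the image of \<open>P \<xi>2\<close>
    under \<open>ext c0\<close>.\<close>
  define h where "h = M (fst \<xi>2) + g2 *\<^sub>R c0"
  define d where "d = g2 *\<^sub>R fst \<xi>1 - g1 *\<^sub>R fst \<xi>2"
  have st: "(\<xi>1, y1) \<in> states" "(\<xi>2, y2) \<in> states"
    and e: "\<bar>e1\<bar> = N c0" "\<bar>e2\<bar> = N c0"
    using s1 s2 by (auto simp: extremal_def e1_def e2_def)
  have e1: "e1 = fst y1 \<bullet> M (fst \<xi>1) + g1 * (fst y1 \<bullet> c0)"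
    by (simp add: e1_def val_def base_def slope_def g1_def)
  have e2: "e2 = fst y2 \<bullet> h"
    by (simp add: e2_def val_def base_def slope_def g2_def h_def inner_add_right)
  have "(e1 * g1) *\<^sub>R fst y1 + (\<tau> * e2 * g2) *\<^sub>R fst y2 = 0"
    using opp by (simp add: e1_def e2_def slope_def g1_def g2_def mult.assoc)
  \<comment> \<open>Pairing the relation with \<open>h\<close> turns the second term into a square,
    as \<open>fst y2 \<bullet> h\<close> is \<open>e2\<close>; this determines the mixed term
    \<open>fst y1 \<bullet> h\<close>.\<close>
  then have "((e1 * g1) *\<^sub>R fst y1 + (\<tau> * e2 * g2) *\<^sub>R fst y2) \<bullet> h = 0" by simp
  then have opp': "e1 * g1 * (fst y1 \<bullet> h) = - (\<tau> * g2 * e2\<^sup>2)"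
    by (simp add: inner_add_left e2) algebra
  have sq: "e1\<^sup>2 = (N c0)\<^sup>2" "e2\<^sup>2 = (N c0)\<^sup>2" using e by (metis power2_abs)+
  \<comment> \<open>The choice of \<open>d\<close> makes the contributions of \<open>c0\<close>
    cancel.\<close>
  have "fst y1 \<bullet> M d = g2 * e1 - g1 * (fst y1 \<bullet> h)"
    by (simp add: d_def e1 h_def linear_diff[OF linear_M] linear_cmul[OF linear_M] algebra_simps
        inner_diff_right inner_add_right)
  then have "e1 * (fst y1 \<bullet> M d) = g2 * e1\<^sup>2 - e1 * g1 * (fst y1 \<bullet> h)"
    by algebra
  also have "\<dots> = (N c0)\<^sup>2 * g2 * (1 + \<tau>)"
    unfolding opp' sq by (simp add: algebra_simps)
  finally have "\<bar>e1 * (fst y1 \<bullet> M d)\<bar> = \<bar>(N c0)\<^sup>2 * g2 * (1 + \<tau>)\<bar>" by simp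
  then have "N c0 * \<bar>fst y1 \<bullet> M d\<bar> = N c0 * (N c0 * \<bar>g2\<bar> * (1 + \<tau>))"
    using e(1) \<open>\<tau> > 0\<close> by (simp add: abs_mult power2_eq_square mult.assoc)
  then have "\<bar>fst y1 \<bullet> M d\<bar> = N c0 * \<bar>g2\<bar> * (1 + \<tau>)"
    using pos by simp
  then have val_d: "\<bar>fst y1 \<bullet> M d\<bar> = N c0 * (\<bar>g2\<bar> + \<tau> * \<bar>g2\<bar>)"
    by (simp add: algebra_simps)
  have "\<bar>y1 \<bullet> (M d, 0)\<bar> \<le> norm (P (M d, 0))" using st(1) unfolding states_def by blast
  then have "\<bar>fst y1 \<bullet> M d\<bar> \<le> norm (A (P (d, 0)))" by (simp add: A_P inner_prod_def)
  also have "\<dots> \<le> opnorm_on V A * norm (P (d, 0))" by (simp add: norm_A_le)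
  also have "norm (P (d, 0)) \<le> \<bar>g2\<bar> + \<bar>g1\<bar>"
  proof -
    have "(d, 0) = g2 *\<^sub>R \<xi>1 - g1 *\<^sub>R \<xi>2" by (simp add: prod_eq_iff d_def g1_def g2_def)
    then have "P (d, 0) = g2 *\<^sub>R P \<xi>1 - g1 *\<^sub>R P \<xi>2"
      by (simp add: linear_diff[OF linear_P] linear_cmul[OF linear_P])
    then show ?thesis
      using norm_triangle_ineq4[of "g2 *\<^sub>R P \<xi>1" "g1 *\<^sub>R P \<xi>2"] st by (simp add: states_def)
  qed
  finally have ub: "\<bar>fst y1 \<bullet> M d\<bar> \<le> opnorm_on V A * (\<bar>g2\<bar> + \<bar>g1\<bar>)"
    using opnorm_nonneg by (meson mult_left_mono order_trans)
  \<comment> \<open>By \<open>le\<close>, the stretch in \<open>val_d\<close> dominates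
    \<open>N c0\<close> times the triangle bound for the norm of the witness.\<close>
  have "N c0 * (\<bar>g2\<bar> + \<bar>g1\<bar>) \<le> N c0 * (\<bar>g2\<bar> + \<tau> * \<bar>g2\<bar>)"
    using le pos by (intro mult_left_mono) (auto simp: g1_def g2_def)
  also have "\<dots> \<le> opnorm_on V A * (\<bar>g2\<bar> + \<bar>g1\<bar>)" using ub val_d by simp
  finally have "N c0 * (\<bar>g2\<bar> + \<bar>g1\<bar>) \<le> opnorm_on V A * (\<bar>g2\<bar> + \<bar>g1\<bar>)" .
  moreover have "\<bar>g2\<bar> + \<bar>g1\<bar> > 0" using ne by (simp add: g2_def add_pos_nonneg)
  ultimately show ?thesis by (simp add: mult_le_cancel_right)
qed

text \<open>If \<open>snd \<xi> = 0\<close>, the point lies in \<open>V\<close>, where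
  \<open>ext c0\<close> is \<open>A\<close>, and the value is at most the norm of \<open>A\<close>.
  If \<open>fst y = 0\<close>, the functional vanishes on \<open>V\<close>, which contains the range
  of \<open>ext c0\<close>, and the value is 0.\<close>

lemma extremal_signature_nonzero:
  assumes s: "(\<xi>, y) \<in> extremal c0" and gt: "N c0 > opnorm_on V A"
  shows "snd \<xi> \<noteq> 0" "val (\<xi>, y) c0 *\<^sub>R slope (\<xi>, y) \<noteq> 0"
proof -
  have st: "(\<xi>, y) \<in> states" and e: "\<bar>val (\<xi>, y) c0\<bar> = N c0" using s by (auto simp: extremal_def)
  have pos: "N c0 > 0" using gt opnorm_nonneg by simp
  show g: "snd \<xi> \<noteq> 0"
  proof
    assume 0: "snd \<xi> = 0"
    then have \<xi>: "\<xi> = (fst \<xi>, 0)" by (simp add: prod_eq_iff)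
    have "\<bar>y \<bullet> (M (fst \<xi>), 0)\<bar> \<le> norm (P (M (fst \<xi>), 0))" using st unfolding states_def by blast
    then have "N c0 \<le> norm (A (P (fst \<xi>, 0)))"
      using e 0 by (simp add: val_def base_def slope_def inner_prod_def A_P)
    also have "\<dots> \<le> opnorm_on V A * norm (P (fst \<xi>, 0))" by (simp add: norm_A_le)
    also have "norm (P (fst \<xi>, 0)) = 1" using st \<xi> by (simp add: states_def)
    finally show False using gt by simp
  qed
  have "fst y \<noteq> 0" using e pos by (auto simp: val_def base_def slope_def)
  with g e pos show "val (\<xi>, y) c0 *\<^sub>R slope (\<xi>, y) \<noteq> 0" by (auto simp: slope_def)
qed

lemma opposite_states_impossible:
  assumes s1: "s1 \<in> extremal c0" and s2: "s2 \<in> extremal c0" and gt: "N c0 > opnorm_on V A"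
    and "\<tau> > 0" and opp: "val s1 c0 *\<^sub>R slope s1 + \<tau> *\<^sub>R (val s2 c0 *\<^sub>R slope s2) = 0"
  shows False
proof -
  obtain \<xi>1 y1 \<xi>2 y2 where s: "s1 = (\<xi>1, y1)" "s2 = (\<xi>2, y2)" by (metis surj_pair)
  have pos: "N c0 > 0" using gt opnorm_nonneg by simp
  note ex = s1[unfolded s] s2[unfolded s]
  note ne = extremal_signature_nonzero(1)[OF ex(1) gt] extremal_signature_nonzero(1)[OF ex(2) gt]
  have "N c0 \<le> opnorm_on V A"
  proof (cases "\<bar>snd \<xi>1\<bar> \<le> \<tau> * \<bar>snd \<xi>2\<bar>")
    case True
    show ?thesis using opposite_states_stretch[OF ex pos \<open>\<tau> > 0\<close> True opp[unfolded s] ne(2)] .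
  next
    case False
    \<comment> \<open>Exchanging the two states replaces \<open>\<tau>\<close> by
      \<open>1 / \<tau>\<close> and restores the ordering required by
      \<open>opposite_states_stretch\<close>.\<close>
    then have le: "\<bar>snd \<xi>2\<bar> \<le> (1 / \<tau>) * \<bar>snd \<xi>1\<bar>" using \<open>\<tau> > 0\<close> by (simp add: field_simps)
    have "(1 / \<tau>) *\<^sub>R (val s1 c0 *\<^sub>R slope s1 + \<tau> *\<^sub>R (val s2 c0 *\<^sub>R slope s2)) = 0"
      unfolding opp by simp
    then have "val s2 c0 *\<^sub>R slope s2 + (1 / \<tau>) *\<^sub>R (val s1 c0 *\<^sub>R slope s1) = 0"
      using \<open>\<tau> > 0\<close> by (simp add: scaleR_add_right add.commute)
    then show ?thesis
      using opposite_states_stretch[OF ex(2,1) pos _ le _ ne(1)] \<open>\<tau> > 0\<close> by (simp add: s)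
  qed
  with gt show False by simp
qed

end

section \<open>Uniqueness and strong uniqueness in coordinates\<close>

lemma extension_strongly_unique:
  fixes P :: "(real \<times> real) \<times> real \<Rightarrow> 'a::real_normed_vector"
  assumes "extension_coordinates P V A" and gt: "lambda_w V A > opnorm_on V A"
  shows "\<exists>A0. A0 \<in> extensions V A \<and> numrad A0 = lambda_w V A
            \<and> (\<forall>B. B \<in> extensions V A \<and> numrad B = lambda_w V A \<longrightarrow> B = A0)
            \<and> (\<exists>r>0. \<forall>L\<in>BVXV V. numrad (\<lambda>x. A0 x - L x) \<ge> numrad A0 + r * numrad L)"
proof -
  interpret extension_coordinates P V A by (rule assms(1))
  obtain c0 where min: "\<And>c. N c0 \<le> N c" using minimum_exists slope_nondegenerate by blast
  have "extensions V A = range ext" using ext_extension extension_ext by blast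
  then have "numrad ` extensions V A = range N" by (simp add: image_image numrad_ext)
  then have \<lambda>: "lambda_w V A = N c0"
    unfolding lambda_w_def using min by (auto intro: cInf_eq_minimum)
  with gt have gt: "N c0 > opnorm_on V A" by simp
  then have pos: "N c0 > 0" using opnorm_nonneg by simp
  let ?K = "(\<lambda>s. val s c0 *\<^sub>R slope s) ` extremal c0"
  have "0 \<notin> ?K" using extremal_signature_nonzero(2)[OF _ gt] by force
  \<comment> \<open>Strict surrounding of the origin: a failing direction \<open>u\<close> puts all
    the vectors in a closed half plane, and with Kolmogorov's condition this forces an opposite
    pair.\<close>
  have "\<exists>s\<in>extremal c0. 0 < (val s c0 *\<^sub>R slope s) \<bullet> u" if "norm u = 1" for u
  proof (rule ccontr)
    assume "\<not> ?thesis"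
    then have le: "\<And>k. k \<in> ?K \<Longrightarrow> k \<bullet> u \<le> 0" by (auto simp: not_less)
    have "\<exists>k\<in>?K. 0 \<le> k \<bullet> w" for w using kolmogorov[OF min, of w] by blast
    from opposite_pair[OF compact_signatures this \<open>0 \<notin> ?K\<close> that le]
    obtain s1 s2 \<tau> where "s1 \<in> extremal c0" "s2 \<in> extremal c0" "\<tau> > 0"
      "val s1 c0 *\<^sub>R slope s1 + \<tau> *\<^sub>R (val s2 c0 *\<^sub>R slope s2) = 0" by blast
    then show False using opposite_states_impossible gt by blast
  qed
  then obtain r where r: "r > 0" "\<And>u. N c0 + r * norm u \<le> N (c0 + u)"
    using strongly_unique[OF pos] by blast
  obtain K where K: "K > 0" "\<And>u. numrad (rank1 u) \<le> K * norm u" using numrad_rank1_le by blast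
  \<comment> \<open>A second minimiser would have a parameter at distance 0 from
    \<open>c0\<close>.\<close>
  have "B = ext c0" if "B \<in> extensions V A" "numrad B = lambda_w V A" for B
  proof -
    obtain c where c: "B = ext c" using extension_ext \<open>B \<in> extensions V A\<close> by blast
    then have "N c = N c0" using that(2) \<lambda> by (simp add: numrad_ext)
    then have "r * norm (c - c0) \<le> 0" using r(2)[of "c - c0"] by simp
    then have "c = c0" using r(1) by (simp add: mult_le_0_iff)
    then show ?thesis by (simp add: c)
  qed
  \<comment> \<open>Subtracting \<open>L\<close> shifts the parameter by \<open>- u\<close>;
    dividing \<open>r\<close> by \<open>K\<close> passes from \<open>norm u\<close> to
    \<open>numrad L\<close>.\<close>
  moreover have "numrad (\<lambda>x. ext c0 x - L x) \<ge> numrad (ext c0) + (r / K) * numrad L"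
    if "L \<in> BVXV V" for L
  proof -
    obtain u where u: "L = rank1 u" using BVXV_rank1[OF \<open>L \<in> BVXV V\<close>] by blast
    have "(\<lambda>x. ext c0 x - L x) = ext (c0 + - u)" by (simp add: u ext_diff_rank1 fun_eq_iff)
    moreover have "(r / K) * numrad L \<le> (r / K) * (K * norm u)"
      using r(1) K by (intro mult_left_mono) (auto simp: u)
    then have "(r / K) * numrad L \<le> r * norm u" using K(1) by simp
    ultimately show ?thesis using r(2)[of "- u"] by (simp add: numrad_ext)
  qed
  moreover have "r / K > 0" using r(1) K(1) by simp
  ultimately show ?thesis
    using ext_extension numrad_ext \<lambda> by (intro exI[of _ "ext c0"]) metis
qed

section \<open>Construction of the coordinates\<close>

text \<open>A basis \<open>b1\<close>, \<open>b2\<close> of \<open>V\<close> is completed by one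
  vector \<open>w\<close>; the first factor of the domain carries \<open>V\<close> and the last
  coordinate runs along \<open>w\<close>.\<close>

lemma extension_coordinates_exist:
  fixes V :: "'a::real_normed_vector set"
  assumes dim3: "dim (UNIV :: 'a set) = 3" and V: "subspace V" "dim V = 2" and A: "A \<in> BV V"
  shows "\<exists>P :: (real \<times> real) \<times> real \<Rightarrow> 'a. extension_coordinates P V A"
proof -
  obtain B where B: "B \<subseteq> V" "independent B" "V \<subseteq> span B" "card B = 2"
    using basis_exists[of V] V(2) by metis
  then have span_B: "span B = V" using V(1) by (simp add: span_minimal subset_antisym)
  obtain B' where B': "B \<subseteq> B'" "independent B'" "UNIV \<subseteq> span B'"
    by (rule maximal_independent_subset_extend[of B UNIV]) (use B(2) in auto)
  have "card B' = 3" using basis_card_eq_dim[of B' UNIV] B' dim3 by simp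
  then have "finite B'" by (simp add: card_ge_0_finite)
  then have "card (B' - B) = 1" using B'(1) B(4) \<open>card B' = 3\<close> by (simp add: card_Diff_subset finite_subset)
  then obtain w where "B' - B = {w}" by (auto simp: card_1_singleton_iff)
  then have w: "B' = insert w B" "w \<notin> B" using B'(1) by auto
  obtain b1 b2 where b: "B = {b1, b2}" "b1 \<noteq> b2" using B(4) by (auto simp: card_2_iff)
  have "w \<notin> span {b1, b2}" using B'(2) w by (simp add: b independent_insert)
  have b1: "b1 \<notin> span {b2}" "b2 \<noteq> 0"
    using B(2) b by (auto simp: independent_insert dependent_single)
  define P :: "(real \<times> real) \<times> real \<Rightarrow> 'a" where
    "P p = fst (fst p) *\<^sub>R b1 + snd (fst p) *\<^sub>R b2 + snd p *\<^sub>R w" for p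
  have lin: "linear P" by (rule linearI) (simp_all add: P_def algebra_simps)
  have V_iff: "x \<in> V \<longleftrightarrow> (\<exists>d. x = P (d, 0))" for x
  proof -
    have "x \<in> V \<longleftrightarrow> (\<exists>s t. x - s *\<^sub>R b1 = t *\<^sub>R b2)"
      using span_B b by (auto simp: span_breakdown_eq span_singleton image_iff)
    also have "\<dots> \<longleftrightarrow> (\<exists>d. x = P (d, 0))" by (auto simp: P_def algebra_simps)
    finally show ?thesis .
  qed
  have unscale: "x \<in> span S" if "k *\<^sub>R x \<in> span S" "k \<noteq> 0" for k and x :: 'a and S
    using span_scale[OF that(1), of "inverse k"] that(2) by simp
  have "surj P"
  proof -
    have "\<exists>p. x = P p" for x
    proof -
      have "x \<in> span (insert w B)" using B'(3) w by auto
      then obtain t where "x - t *\<^sub>R w \<in> V" by (auto simp: span_breakdown_eq span_B)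
      then obtain d where "x - t *\<^sub>R w = P (d, 0)" using V_iff by blast
      then have "x = P (d, t)" by (simp add: P_def algebra_simps)
      then show ?thesis by blast
    qed
    then show ?thesis by (auto simp: surj_def)
  qed
  moreover have "inj P"
  proof -
    \<comment> \<open>Coordinates are eliminated one at a time: that of \<open>w\<close> because
      \<open>w\<close> lies outside the span of \<open>b1\<close> and \<open>b2\<close>, then that
      of \<open>b1\<close>, then that of \<open>b2\<close>.\<close>
    have "p = 0" if "P p = 0" for p
    proof -
      have eq: "fst (fst p) *\<^sub>R b1 + snd (fst p) *\<^sub>R b2 + snd p *\<^sub>R w = 0"
        using that by (simp add: P_def)
      have "snd p *\<^sub>R w = - (fst (fst p) *\<^sub>R b1 + snd (fst p) *\<^sub>R b2)"
        using eq by (simp only: add_eq_0_iff)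
      moreover have "fst (fst p) *\<^sub>R b1 + snd (fst p) *\<^sub>R b2 \<in> span {b1, b2}"
        by (intro span_add span_scale span_base) auto
      ultimately have "snd p *\<^sub>R w \<in> span {b1, b2}" using span_neg by metis
      then have 3: "snd p = 0" using \<open>w \<notin> span {b1, b2}\<close> unscale by blast
      have "fst (fst p) *\<^sub>R b1 = - (snd (fst p) *\<^sub>R b2)"
        using eq 3 by (simp add: eq_neg_iff_add_eq_0)
      then have "fst (fst p) *\<^sub>R b1 \<in> span {b2}" by (simp add: span_neg span_scale span_base)
      then have 1: "fst (fst p) = 0" using b1(1) unscale by blast
      then have "snd (fst p) = 0" using eq 3 b1(2) by simp
      with 1 3 show ?thesis by (simp add: prod_eq_iff)
    qed
    then show ?thesis using lin by (simp add: linear_injective_0)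
  qed
  moreover have "V = range (\<lambda>d. P (d, 0))" using V_iff by auto
  ultimately have "extension_coordinates P V A"
    using lin A
    by (simp add: extension_coordinates_def extension_coordinates_axioms_def coordinates_def bij_def)
  then show ?thesis by blast
qed

theorem theorem3p3:
  fixes V :: "'a::banach set" and A :: "'a \<Rightarrow> 'a"
  assumes "dim (UNIV :: 'a set) = 3"
    and "subspace V" and "dim V = 2"
    and "A \<in> BV V"
    and "numrad_on V A > 0"
    and "lambda_w V A > opnorm_on V A"
  shows "\<exists>A0. A0 \<in> extensions V A \<and> numrad A0 = lambda_w V A
            \<and> (\<forall>B. B \<in> extensions V A \<and> numrad B = lambda_w V A \<longrightarrow> B = A0)
            \<and> (\<exists>r>0. \<forall>L\<in>BVXV V. numrad (\<lambda>x. A0 x - L x) \<ge> numrad A0 + r * numrad L)"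
proof -
  obtain P :: "(real \<times> real) \<times> real \<Rightarrow> 'a" where "extension_coordinates P V A"
    using extension_coordinates_exist assms(1-4) by blast
  then show ?thesis using extension_strongly_unique assms(6) by blast
qed

end
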